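(* Let $p\in\mathcal{P}^{\log}(\mathbb{R}^n)$ and $m>n$ with $2\le p^-\le p^+<+\infty$ and $p^+=p_\infty$. Then there is a constant $C>0$, depending only on the exponent $p$ and on $m$, such that for every $t\in(0,+\infty)$ and every $f\in L^{p(\cdot)/2}(\mathbb{R}^n)$, $$\|\eta_{t,m}*f\|_{L^{p(\cdot)}(\mathbb{R}^n)}\le C\,t^{-n\vartheta(t)}\,\|f\|_{L^{p(\cdot)/2}(\mathbb{R}^n)},$$ where $$\vartheta(t)=\begin{cases}\left(\frac{2}{p^-}-\frac{1}{p_\infty}\right)\left(\frac{2+p_\infty(1-\frac{2}{p^-})}{1+p_\infty(1-\frac{2}{p^-})}-\frac{1}{p_\infty-1}\right), & 0<t\le 1,\\[4pt] \frac{1}{p_\infty}\left(\frac{p_\infty(1-\frac{2}{p^-})}{1+p_\infty(1-\frac{2}{p^-})}+\frac{1}{p_\infty-1}\right), & t>1.\end{cases}$$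
   Context: $\mathcal{P}(\mathbb{R}^n)$ is the set of measurable functions $p:\mathbb{R}^n\to[1,\infty]$; $p^-$ and $p^+$ are the essential infimum and supremum of $p$; $\frac1\infty:=0$. The modular is $\varrho_{p(\cdot)}(f)=\int_{\mathbb{R}^n}\omega_{p(x)}(|f(x)|)\,dx$, with $\omega_p(t)=t^p$ if $p<\infty$, and $\omega_\infty(t)=0$ for $t\le1$, $\omega_\infty(t)=\infty$ for $t>1$. $L^{p(\cdot)}(\mathbb{R}^n)$ is the space of measurable $f$ with $\varrho_{p(\cdot)}(\lambda f)<\infty$ for some $\lambda>0$, normed by $\|f\|_{L^{p(\cdot)}}=\inf\{\lambda>0:\varrho_{p(\cdot)}(f/\lambda)\le1\}$. A real function $g$ on $\mathbb{R}^n$ is globally log-Hölder continuous if there are $c>0$ and $g_\infty\in\mathbb{R}$ with $|g(x)-g(y)|\le \frac{c}{\log(e+1/|x-y|)}$ and $|g(x)-g_\infty|\le\frac{c}{\log(e+|x|)}$ for all $x,y$. $\mathcal{P}^{\log}(\mathbb{R}^n)$ is the set of $p\in\mathcal{P}(\mathbb{R}^n)$ with $1/p$ globally log-Hölder continuous, and $p_\infty\in[1,\infty]$ is defined by $\frac1{p_\infty}=\lim_{|x|\to\infty}\frac1{p(x)}$. $\eta_{t,m}(x):=t^{-n}(1+t^{-1}|x|)^{-m}$ for $x\in\mathbb{R}^n$, $t>0$, $m>0$. *)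

theory Defs
  imports "HOL-Analysis.Analysis" "HOL-Probability.Essential_Supremum"
begin

text \<open>
  Exponents take values in \<open>[1, \<infinity>] \<subseteq> ennreal\<close>, where \<open>1 / \<infinity> = 0\<close> and \<open>\<infinity> / 2 = \<infinity>\<close>.
  Measurability is with respect to the Lebesgue sigma-algebra.
\<close>

definition var_exponents :: "('a::euclidean_space \<Rightarrow> ennreal) set"  where
  "var_exponents = {p. p \<in> borel_measurable lebesgue \<and> (\<forall>x. 1 \<le> p x)}"

definition exp_plus :: "('a::euclidean_space \<Rightarrow> ennreal) \<Rightarrow> ennreal" where
  "exp_plus p = esssup lebesgue p"

definition exp_minus :: "('a::euclidean_space \<Rightarrow> ennreal) \<Rightarrow> ennreal" where
  "exp_minus p = Sup {z. AE x in lebesgue. z \<le> p x}"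

definition omega :: "ennreal \<Rightarrow> real \<Rightarrow> ennreal" where
  "omega p t =
    (if p = \<infinity> then (if t \<le> 1 then 0 else \<infinity>) else ennreal (t powr enn2real p))"

definition modular ::
  "('a::euclidean_space \<Rightarrow> ennreal) \<Rightarrow> ('a \<Rightarrow> 'b::real_normed_vector) \<Rightarrow> ennreal" where
  "modular p f = (\<integral>\<^sup>+ x. omega (p x) (norm (f x)) \<partial>lebesgue)"

definition Lp_var ::
  "('a::euclidean_space \<Rightarrow> ennreal) \<Rightarrow> ('a \<Rightarrow> 'b::real_normed_vector) set" where
  "Lp_var p = {f. f \<in> borel_measurable lebesgue \<and>
     (\<exists>l>0. modular p (\<lambda>x. l *\<^sub>R f x) < \<infinity>)}"

text \<open>The Luxemburg norm is taken in \<^typ>\<open>ennreal\<close>, so that the infimum of the empty set is \<open>\<infinity>\<close>.\<close>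

definition Lp_var_norm ::
  "('a::euclidean_space \<Rightarrow> ennreal) \<Rightarrow> ('a \<Rightarrow> 'b::real_normed_vector) \<Rightarrow> ennreal" where
  "Lp_var_norm p f = (INF l \<in> {l::real. 0 < l \<and> modular p (\<lambda>x. f x /\<^sub>R l) \<le> 1}. ennreal l)"

text \<open>For \<open>x = y\<close> the convention \<open>1 / 0 = 0\<close> makes the first inequality \<open>0 \<le> c\<close>, which is harmless.\<close>

definition log_Hoelder :: "('a::euclidean_space \<Rightarrow> real) \<Rightarrow> bool" where
  "log_Hoelder g \<longleftrightarrow> (\<exists>c>0. \<exists>g_inf.
     (\<forall>x y. \<bar>g x - g y\<bar> \<le> c / ln (exp 1 + 1 / norm (x - y))) \<and>
     (\<forall>x. \<bar>g x - g_inf\<bar> \<le> c / ln (exp 1 + norm x)))"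

definition log_exponents :: "('a::euclidean_space \<Rightarrow> ennreal) set" where
  "log_exponents = {p \<in> var_exponents. log_Hoelder (\<lambda>x. enn2real (1 / p x))}"

text \<open>The limit exists for exponents in \<^const>\<open>log_exponents\<close>; it may be \<open>0\<close>, giving the value \<open>\<infinity>\<close>.\<close>

definition exp_infty :: "('a::euclidean_space \<Rightarrow> ennreal) \<Rightarrow> ennreal" where
  "exp_infty p = 1 / Lim at_infinity (\<lambda>x. 1 / p x)"

definition eta :: "real \<Rightarrow> real \<Rightarrow> 'a::euclidean_space \<Rightarrow> real" where
  "eta t m x = t powr (- real DIM('a)) * (1 + norm x / t) powr (- m)"

text \<open>
  The Bochner integral is \<open>0\<close> for non-integrable integrands, hence the separate existence predicate.
\<close>

definition conv_exists ::
  "('a::euclidean_space \<Rightarrow> real) \<Rightarrow> ('a \<Rightarrow> 'b::{banach, second_countable_topology}) \<Rightarrow> bool" where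
  "conv_exists g f \<longleftrightarrow> (AE x in lebesgue. integrable lebesgue (\<lambda>y. g (x - y) *\<^sub>R f y))"

definition conv ::
  "('a::euclidean_space \<Rightarrow> real) \<Rightarrow> ('a \<Rightarrow> 'b::{banach, second_countable_topology}) \<Rightarrow> 'a \<Rightarrow> 'b" where
  "conv g f x = (LINT y|lebesgue. g (x - y) *\<^sub>R f y)"

definition theta :: "real \<Rightarrow> real \<Rightarrow> real \<Rightarrow> real" where
  "theta p_minus p_infty t =
    (if t \<le> 1 then
       (2 / p_minus - 1 / p_infty) *
       ((2 + p_infty * (1 - 2 / p_minus)) / (1 + p_infty * (1 - 2 / p_minus))
         - 1 / (p_infty - 1))
     else
       1 / p_infty *
       (p_infty * (1 - 2 / p_minus) / (1 + p_infty * (1 - 2 / p_minus))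
         + 1 / (p_infty - 1)))"

end

theory Submission
  imports Defs
begin

text \<open>
  Write \<open>a = p\<^sup>-\<close>, \<open>P = p\<^sup>+ = p\<^sub>\<infinity>\<close>, and let \<open>F = |f|\<close> to the power \<open>p(x)/2\<close> have integral at most \<open>1\<close>.
  Pointwise, \<open>|f| \<le> F powr (2/a) + F powr (2/P)\<close>, so a Jensen-type inequality bounds \<open>\<eta> * |f|\<close> by
  \<open>A powr (2/a) + A powr (2/P)\<close> up to a constant, where \<open>A = \<eta> * F\<close>.  Since \<open>A \<le> t powr (- n)\<close>,
  both terms are at most \<open>t powr (- n\<vartheta>(t)) * A powr (1/P)\<close>, because \<open>2/a - 1/P \<le> \<vartheta>(t)\<close> for \<open>t \<le> 1\<close>
  and \<open>\<vartheta>(t) \<le> 1/P\<close> for \<open>t > 1\<close>.  As \<open>A powr (1/P)\<close> lies in the constant-exponent space \<open>L\<^sup>P\<close>, it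
  remains to embed \<open>L\<^sup>P\<close> into \<open>L\<^bsup>p(x)\<^esup>\<close>; this uses \<open>p \<le> P\<close> and the logarithmic decay of
  \<open>1/p - 1/P\<close>.
\<close>

section \<open>Lebesgue measure: sigma-finiteness and changes of variables\<close>

text \<open>Needed for Fubini over \<open>lebesgue\<close>: a countable Borel cover by sets of
  finite measure also serves the completion.\<close>

lemma sigma_finite_lebesgue: "sigma_finite_measure (lebesgue :: 'a::euclidean_space measure)"
proof
  obtain A :: "'a set set" where "countable A" "A \<subseteq> sets lborel" "\<Union>A = space lborel"
      "\<forall>a\<in>A. emeasure lborel a \<noteq> \<infinity>"
    using lborel.sigma_finite_countable by blast
  then show "\<exists>A::'a set set. countable A \<and> A \<subseteq> sets lebesgue \<and> \<Union>A = space lebesgue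
      \<and> (\<forall>a\<in>A. emeasure lebesgue a \<noteq> \<infinity>)"
    by (intro exI[of _ A]) (auto simp: subset_iff)
qed

interpretation lebesgue: sigma_finite_measure lebesgue
  by (rule sigma_finite_lebesgue)
interpretation lebesgue_pair: pair_sigma_finite lebesgue lebesgue
  by unfold_locales

lemma nn_integral_lebesgue_reflect:
  fixes g :: "'a::euclidean_space \<Rightarrow> ennreal"
  assumes [measurable]: "g \<in> borel_measurable borel"
  shows "(\<integral>\<^sup>+y. g (x - y) \<partial>lebesgue) = (\<integral>\<^sup>+y. g y \<partial>lebesgue)"
proof -
  have "(\<integral>\<^sup>+y. g y \<partial>lborel) = (\<integral>\<^sup>+y. g (x - y) \<partial>lborel)"
    by (subst lborel_affine[of "-1" x]) (simp_all add: nn_integral_density nn_integral_distr)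
  then show ?thesis
    by (simp add: nn_integral_completion)
qed

lemma nn_integral_lebesgue_translate:
  fixes g :: "'a::euclidean_space \<Rightarrow> ennreal"
  assumes [measurable]: "g \<in> borel_measurable borel"
  shows "(\<integral>\<^sup>+x. g (x - y) \<partial>lebesgue) = (\<integral>\<^sup>+x. g x \<partial>lebesgue)"
proof -
  have "(\<integral>\<^sup>+x. g x \<partial>lborel) = (\<integral>\<^sup>+x. g (x - y) \<partial>lborel)"
    by (subst lborel_affine[of 1 "-y"]) (simp_all add: nn_integral_density nn_integral_distr)
  then show ?thesis
    by (simp add: nn_integral_completion)
qed

section \<open>The kernel \<open>eta\<close> and its mass, uniformly in the scale\<close>

lemma eta_measurable [measurable]: "eta t m \<in> borel_measurable borel"
  unfolding eta_def by measurable

lemma eta_nonneg [simp]: "0 \<le> eta t m x"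
  by (simp add: eta_def)

lemma eta_le:
  assumes "0 < t" "0 \<le> m"
  shows "eta t m (x::'a::euclidean_space) \<le> t powr (- real DIM('a))"
proof -
  have "(1 + norm x / t) powr (- m) \<le> 1"
    using assms by (simp add: powr_minus ge_one_powr_ge_zero inverse_le_1_iff)
  then show ?thesis
    unfolding eta_def by (simp add: mult_left_le)
qed

text \<open>At a point with \<open>norm x / t\<close> between 2^(k-1) and 2^k, the kernel is at most
  the coefficient of the k-th ball. Balls instead of annuli only enlarge the sum, and their volumes
  are known, so it can be integrated term by term.\<close>

lemma eta_le_dyadic_sum:
  fixes x :: "'a::euclidean_space"
  assumes "0 < t" "0 < m"
  shows "ennreal (eta t m x) \<le> (\<Sum>k. ennreal (t powr (- real DIM('a)) * 2 powr m * (2 powr (- m)) ^ k)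
           * indicator (cball 0 (t * 2 ^ k)) x)"
proof -
  define u where "u = norm x / t"
  have u0: "0 \<le> u" using assms by (simp add: u_def)
  obtain N :: nat where "u < 2 ^ N" using real_arch_pow[of 2 u] by auto
  then have ex: "\<exists>k::nat. u \<le> 2 ^ k" by (intro exI[of _ N]) simp
  define k where "k = (LEAST k::nat. u \<le> 2 ^ k)"
  have k: "u \<le> 2 ^ k" unfolding k_def by (rule LeastI_ex[OF ex])
  \<comment> \<open>For k = 0 the claim is 1/2 <= 1 + u; otherwise minimality of \<open>k\<close>
    gives 2^(k-1) < u.\<close>
  have lower: "2 powr (real k - 1) \<le> 1 + u"
  proof (cases k)
    case 0
    then show ?thesis using u0 by (simp add: powr_minus)
  next
    case (Suc j)
    then have "\<not> u \<le> 2 ^ j" using not_less_Least[of j "\<lambda>k. u \<le> 2 ^ k"] by (simp add: k_def)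
    then show ?thesis using Suc by (simp add: powr_realpow)
  qed
  have "(1 + u) powr (- m) \<le> (2 powr (real k - 1)) powr (- m)"
    using lower assms by (intro powr_mono2') auto
  also have "\<dots> = 2 powr m * (2 powr (- m)) ^ k"
    by (simp add: powr_powr powr_add[symmetric] powr_realpow[symmetric] algebra_simps)
  finally have "eta t m x \<le> t powr (- real DIM('a)) * 2 powr m * (2 powr (- m)) ^ k"
    unfolding eta_def u_def by (simp add: mult.assoc mult_left_mono)
  moreover have "x \<in> cball 0 (t * 2 ^ k)"
    using k assms by (simp add: u_def field_simps)
  moreover define h where "h = (\<lambda>k. ennreal (t powr (- real DIM('a)) * 2 powr m * (2 powr (- m)) ^ k)
           * indicator (cball 0 (t * 2 ^ k)) x)"
  ultimately have "ennreal (eta t m x) \<le> h k"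
    by (simp add: h_def ennreal_leI)
  also have "h k \<le> (\<Sum>k. h k)"
    using sum_le_suminf[of h "{k}"] by simp
  finally show ?thesis by (simp add: h_def)
qed

text \<open>The dyadic bound integrates to a geometric series of ratio 2^(n-m), convergent since m >
  n. The factor t^(-n) cancels the t^n of the ball volumes, so \<open>K\<close> does not depend on
  t.\<close>

lemma nn_integral_eta_bounded:
  assumes "real DIM('a::euclidean_space) < m"
  shows "\<exists>K>0. \<forall>t>0. (\<integral>\<^sup>+x. ennreal (eta t m (x::'a)) \<partial>lebesgue) \<le> ennreal K"
proof -
  define n where "n = DIM('a)"
  define V where "V = unit_ball_vol (real n)"
  define q :: real where "q = 2 powr (real n - m)"
  have V: "0 < V" by (simp add: V_def)
  have q: "0 < q" "q < 1" using assms by (simp_all add: q_def n_def powr_less_one)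
  have m: "0 < m" using assms by (smt (verit) of_nat_0_le_iff)
  have term_eq: "t powr (- real n) * 2 powr m * (2 powr (- m)) ^ k * (V * (t * 2 ^ k) ^ n)
      = V * 2 powr m * q ^ k" if t: "0 < t" for t :: real and k :: nat
  proof -
    have "t powr (- real n) * t ^ n = 1"
      using t by (simp add: powr_minus powr_realpow)
    moreover have "(2 powr (- m)) ^ k * (2 ^ k) ^ n = q ^ k"
      by (simp add: q_def powr_realpow[symmetric] powr_powr powr_add[symmetric] algebra_simps)
    moreover have "t powr (- real n) * 2 powr m * (2 powr (- m)) ^ k * (V * (t * 2 ^ k) ^ n)
      = V * 2 powr m * (t powr (- real n) * t ^ n) * ((2 powr (- m)) ^ k * (2 ^ k) ^ n)"
      by (simp add: power_mult_distrib)
    ultimately show ?thesis by simp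
  qed
  have "(\<integral>\<^sup>+x. ennreal (eta t m (x::'a)) \<partial>lebesgue) \<le> ennreal (\<Sum>k. V * 2 powr m * q ^ k)"
    if t: "0 < t" for t
  proof -
    have "(\<integral>\<^sup>+x. ennreal (eta t m (x::'a)) \<partial>lborel) \<le>
      (\<integral>\<^sup>+x. (\<Sum>k. ennreal (t powr (- real n) * 2 powr m * (2 powr (- m)) ^ k)
           * indicator (cball 0 (t * 2 ^ k)) (x::'a)) \<partial>lborel)"
      unfolding n_def by (intro nn_integral_mono eta_le_dyadic_sum t m)
    also have "\<dots> = (\<Sum>k. ennreal (t powr (- real n) * 2 powr m * (2 powr (- m)) ^ k)
           * emeasure lborel (cball (0::'a) (t * 2 ^ k)))"
    proof -
      have "(\<integral>\<^sup>+x. (\<Sum>k. c k * indicator (cball 0 (t * 2 ^ k)) (x::'a)) \<partial>lborel)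
          = (\<Sum>k. c k * emeasure lborel (cball (0::'a) (t * 2 ^ k)))" for c :: "nat \<Rightarrow> ennreal"
        by (subst nn_integral_suminf)
          (auto simp: nn_integral_cmult_indicator intro!: borel_measurable_times_ennreal borel_measurable_indicator)
      then show ?thesis .
    qed
    also have "\<dots> = (\<Sum>k. ennreal (V * 2 powr m * q ^ k))"
    proof (intro suminf_cong)
      fix k :: nat
      have "emeasure lborel (cball (0::'a) (t * 2 ^ k)) = ennreal (V * (t * 2 ^ k) ^ n)"
        using t by (subst emeasure_cball) (simp_all add: V_def n_def)
      then show "ennreal (t powr (- real n) * 2 powr m * (2 powr (- m)) ^ k)
           * emeasure lborel (cball (0::'a) (t * 2 ^ k)) = ennreal (V * 2 powr m * q ^ k)"
        by (simp only: term_eq[OF t] ennreal_mult'[symmetric] powr_ge_zero mult_nonneg_nonneg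
            zero_le_power)
    qed
    also have "\<dots> = ennreal (\<Sum>k. V * 2 powr m * q ^ k)"
      using q V by (intro suminf_ennreal2 summable_mult summable_geometric) auto
    finally show ?thesis by (simp add: nn_integral_completion)
  qed
  moreover have "0 < (\<Sum>k. V * 2 powr m * q ^ k)"
    using q V by (intro suminf_pos summable_mult summable_geometric) auto
  ultimately show ?thesis by blast
qed

section \<open>Elementary inequalities: Jensen, the exponent \<open>theta\<close>, variable
  powers\<close>

text \<open>A bound linear in F with a free threshold l: a value u = F^(1/s) above l satisfies u =
  u^(1-s) * F <= l^(1-s) * F, since 1 - s <= 0.\<close>

lemma powr_inverse_le:
  fixes s :: real
  assumes "1 \<le> s" "0 < l" "0 \<le> F"
  shows "F powr (1 / s) \<le> l + l powr (1 - s) * F"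
proof (cases "F powr (1 / s) \<le> l")
  case True
  then show ?thesis using assms by (simp add: add_increasing2)
next
  case False
  define u where "u = F powr (1 / s)"
  have u: "l < u" "F = u powr s" using False assms by (auto simp: u_def powr_powr)
  have "u = u powr (1 - s) * u powr s" using u assms by (simp add: powr_add[symmetric])
  also have "\<dots> \<le> l powr (1 - s) * u powr s"
    using u assms by (intro mult_right_mono powr_mono2') auto
  finally have "u \<le> l powr (1 - s) * F" by (simp only: u(2)[symmetric])
  then show ?thesis using assms(2) unfolding u_def by linarith
qed

text \<open>This plays the role of Jensen's inequality for the measure with density k. The linear
  bound is integrated with l = A^(1/s), which makes both terms multiples of A^(1/s).\<close>

lemma nn_integral_powr_inverse_le:
  fixes k F :: "'b \<Rightarrow> real"
  assumes [measurable]: "k \<in> borel_measurable M" "F \<in> borel_measurable M"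
    and nonneg: "\<And>x. 0 \<le> k x" "\<And>x. 0 \<le> F x"
    and K: "(\<integral>\<^sup>+x. ennreal (k x) \<partial>M) \<le> ennreal K" "0 \<le> K"
    and A: "(\<integral>\<^sup>+x. ennreal (k x * F x) \<partial>M) \<le> ennreal A" "0 \<le> A"
    and s: "1 \<le> s"
  shows "(\<integral>\<^sup>+x. ennreal (k x * F x powr (1 / s)) \<partial>M) \<le> ennreal ((K + 1) * A powr (1 / s))"
\<comment> \<open>The threshold must be positive, so A = 0 is treated apart: then k * F vanishes
  almost everywhere, and with it k * F^(1/s).\<close>
proof (cases "A = 0")
  case True
  then have "AE x in M. ennreal (k x * F x) = 0"
    using A by (subst nn_integral_0_iff_AE[symmetric]) auto
  then have "AE x in M. ennreal (k x * F x powr (1 / s)) = 0"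
    by eventually_elim (use nonneg in \<open>auto simp: ennreal_eq_0_iff mult_le_0_iff order_antisym\<close>)
  then have "(\<integral>\<^sup>+x. ennreal (k x * F x powr (1 / s)) \<partial>M) = 0"
    by (subst nn_integral_0_iff_AE) auto
  then show ?thesis by simp
next
  case False
  then have A0: "0 < A" using A by simp
  define l where "l = A powr (1 / s)"
  have l: "0 < l" using A0 by (simp add: l_def)
  have lA: "l powr (1 - s) * A = l"
  proof -
    have "l powr (1 - s) * A = A powr ((1 - s) / s) * A powr 1"
      using A0 by (simp add: l_def powr_powr)
    also have "\<dots> = l"
      unfolding l_def powr_add[symmetric] using s by (simp add: field_simps)
    finally show ?thesis .
  qed
  have "(\<integral>\<^sup>+x. ennreal (k x * F x powr (1 / s)) \<partial>M)
    \<le> (\<integral>\<^sup>+x. ennreal l * ennreal (k x) + ennreal (l powr (1 - s)) * ennreal (k x * F x) \<partial>M)"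
  proof (intro nn_integral_mono)
    fix x
    have "k x * F x powr (1 / s) \<le> k x * (l + l powr (1 - s) * F x)"
      using powr_inverse_le[OF s l nonneg(2)] nonneg by (intro mult_left_mono) auto
    then show "ennreal (k x * F x powr (1 / s)) \<le>
        ennreal l * ennreal (k x) + ennreal (l powr (1 - s)) * ennreal (k x * F x)"
      using l nonneg
      by (simp add: ennreal_mult'[symmetric] ennreal_plus[symmetric] ennreal_leI algebra_simps
          del: ennreal_plus)
  qed
  also have "\<dots> = ennreal l * (\<integral>\<^sup>+x. ennreal (k x) \<partial>M)
      + ennreal (l powr (1 - s)) * (\<integral>\<^sup>+x. ennreal (k x * F x) \<partial>M)"
    by (subst nn_integral_add) (simp_all add: nn_integral_cmult)
  also have "\<dots> \<le> ennreal l * ennreal K + ennreal (l powr (1 - s)) * ennreal A"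
    by (intro add_mono mult_left_mono K A) auto
  also have "\<dots> = ennreal ((K + 1) * l)"
    using l K A lA by (simp add: ennreal_mult'[symmetric] ennreal_plus[symmetric] algebra_simps
          del: ennreal_plus)
  finally show ?thesis by (simp add: l_def)
qed

text \<open>With s = P * (1 - 2/a) and d = 1/(1+s) - 1/(P-1), the second factor in
  \<open>theta\<close> is 1 + d for t <= 1 and 1 - d for t > 1. Since a <= P, one has s <= P - 2,
  hence d >= 0.\<close>

lemma theta_bounds:
  assumes "2 \<le> a" "a \<le> P"
  shows theta_ge: "t \<le> 1 \<Longrightarrow> 2 / a - 1 / P \<le> theta a P t"
    and theta_le: "1 < t \<Longrightarrow> theta a P t \<le> 1 / P"
proof -
  define s where "s = P * (1 - 2 / a)"
  have s0: "0 \<le> s" using assms by (simp add: s_def)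
  have "2 \<le> 2 * P / a" using assms by (simp add: field_simps)
  then have s: "s \<le> P - 2" by (simp add: s_def algebra_simps)
  have frac: "1 / (P - 1) \<le> 1 / (1 + s)"
    using s s0 assms by (intro divide_left_mono) auto
  have "(2 + s) / (1 + s) = 1 + 1 / (1 + s)" using s0 by (simp add: field_simps)
  then have "1 \<le> (2 + s) / (1 + s) - 1 / (P - 1)" using frac by simp
  moreover have "0 \<le> 2 / a - 1 / P" using assms by (simp add: field_simps)
  ultimately show "t \<le> 1 \<Longrightarrow> 2 / a - 1 / P \<le> theta a P t"
    using mult_left_mono[of 1 "(2 + s) / (1 + s) - 1 / (P - 1)" "2 / a - 1 / P"]
    by (simp add: theta_def s_def)
  have "s / (1 + s) = 1 - 1 / (1 + s)" using s0 by (simp add: field_simps)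
  then have "s / (1 + s) + 1 / (P - 1) \<le> 1" using frac by simp
  then show "1 < t \<Longrightarrow> theta a P t \<le> 1 / P"
    using assms mult_left_mono[of "s / (1 + s) + 1 / (P - 1)" 1 "1 / P"]
    by (simp add: theta_def s_def)
qed

text \<open>Young's inequality for \<open>1/r = 1/P + 1/s\<close>; with \<open>L = ln (e + |x|)\<close> the error term is
  integrable for \<open>m > n\<close>, which explains the choice of the factor \<open>exp (- c * m)\<close>.\<close>

lemma powr_le_powr_plus_decay:
  fixes g r P c m L :: real
  assumes g: "0 \<le> g" and r: "1 \<le> r" "r \<le> P" and c: "0 < c" and m: "0 \<le> m" and L: "0 < L"
    and decay: "1 / r - 1 / P \<le> c / L"
  shows "(exp (- c * m) * g) powr r \<le> g powr P + exp (- m * L)"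
proof -
  define k where "k = exp (- c * m)"
  have k: "0 < k" "k \<le> 1" using c m by (auto simp: k_def)
  have "(k * g) powr r \<le> g powr P + exp (- m * L)"
  \<comment> \<open>Afterwards r < P, so that division by P - r makes sense; for r = P the bound k
    <= 1 is enough.\<close>
  proof (cases "g = 0 \<or> r = P")
    case True
    then show ?thesis
    proof
      assume "g = 0"
      then show ?thesis using r by simp
    next
      assume "r = P"
      then have "(k * g) powr r \<le> g powr P"
        using k g r powr_mono2[of P "k * g" g] by (auto simp: mult_left_le_one_le)
      then show ?thesis by (simp add: add_increasing2)
    qed
  next
    case False
    then have g: "0 < g" and rP: "r < P" using g r by auto
    \<comment> \<open>In terms of this s the decay condition says L <= c * s, so that k^s = exp (- c
      * m * s) <= exp (- m * L).\<close>
    define s where "s = r * P / (P - r)"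
    have s: "0 < s" "1 / s = 1 / r - 1 / P" using r rP by (auto simp: s_def field_simps)
    have "1 / s \<le> c / L" using decay s(2) by simp
    then have sL: "L \<le> c * s" using s(1) L by (simp add: field_simps)
    show ?thesis
    \<comment> \<open>Either k^r is absorbed by g^(P-r), which leaves g^P, or g^r <= k^(r*r/(P-r)),
      and the exponents of k add up to r + r*r/(P-r) = s.\<close>
    proof (cases "k powr r \<le> g powr (P - r)")
      case True
      have "(k * g) powr r = k powr r * g powr r" using k g by (simp add: powr_mult)
      also have "\<dots> \<le> g powr (P - r) * g powr r" using True by (intro mult_right_mono) auto
      also have "\<dots> = g powr P" by (simp add: powr_add[symmetric])
      finally show ?thesis by (simp add: add_increasing2)
    next
      case False
      then have "(g powr (P - r)) powr (r / (P - r)) \<le> (k powr r) powr (r / (P - r))"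
        using r rP by (intro powr_mono2) auto
      then have gr: "g powr r \<le> k powr (r * r / (P - r))"
        using rP by (simp add: powr_powr)
      have "(k * g) powr r = k powr r * g powr r" using k g by (simp add: powr_mult)
      also have "\<dots> \<le> k powr r * k powr (r * r / (P - r))"
        using gr by (intro mult_left_mono) auto
      also have "\<dots> = k powr s"
        using rP by (simp add: powr_add[symmetric] s_def field_simps)
      also have "\<dots> = exp (- m * (c * s))" by (simp add: k_def powr_def)
      also have "\<dots> \<le> exp (- m * L)" using sL m by (simp add: mult_left_mono)
      finally show ?thesis by (simp add: add_increasing)
    qed
  qed
  then show ?thesis by (simp add: k_def)
qed

section \<open>Real bounds for the exponent\<close>

text \<open>A supremum of arbitrarily many almost-everywhere bounds is reached by a sequence of
  them, so only countably many null sets have to be united.\<close>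

lemma exp_minus_le_AE: "AE x in lebesgue. exp_minus p \<le> p x"
proof -
  let ?S = "{z. AE x in lebesgue. z \<le> p x}"
  have "?S \<noteq> {}" by (auto intro: exI[of _ 0])
  then obtain u :: "nat \<Rightarrow> ennreal" where u: "range u \<subseteq> ?S" "Sup ?S = (SUP i. u i)"
    using ennreal_Sup_countable_SUP[of ?S] by auto
  then have "AE x in lebesgue. \<forall>i. u i \<le> p x"
    by (auto simp: AE_all_countable)
  then show ?thesis
    unfolding exp_minus_def u(2) by eventually_elim (auto intro: SUP_least)
qed

text \<open>Identifies the limit inside \<open>exp_infty\<close>. The bound 1 <= p keeps 1/p finite,
  so the real limit lifts to \<open>ennreal\<close>.\<close>

lemma inverse_exponent_tendsto:
  fixes p :: "'a::euclidean_space \<Rightarrow> ennreal"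
  assumes p: "\<And>x. 1 \<le> p x"
    and decay: "\<And>x. \<bar>enn2real (1 / p x) - q\<bar> \<le> c / ln (exp 1 + norm x)"
  shows "((\<lambda>x. 1 / p x) \<longlongrightarrow> ennreal q) at_infinity"
proof -
  have "filterlim (\<lambda>x::'a. exp 1 + norm x) at_top at_infinity"
    by (intro filterlim_tendsto_add_at_top[OF tendsto_const] filterlim_norm_at_top)
  then have "filterlim (\<lambda>x::'a. ln (exp 1 + norm x)) at_top at_infinity"
    by (rule filterlim_compose[OF ln_at_top])
  then have "((\<lambda>x::'a. c / ln (exp 1 + norm x)) \<longlongrightarrow> 0) at_infinity"
    by (intro tendsto_divide_0[OF tendsto_const] filterlim_at_top_imp_at_infinity)
  then have "((\<lambda>x. enn2real (1 / p x) - q) \<longlongrightarrow> 0) at_infinity"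
    by (rule Lim_null_comparison[rotated]) (use decay in auto)
  then have "((\<lambda>x. enn2real (1 / p x)) \<longlongrightarrow> q) at_infinity"
    by (simp add: LIM_zero_iff)
  then have "((\<lambda>x. ennreal (enn2real (1 / p x))) \<longlongrightarrow> ennreal q) at_infinity"
    by (rule tendsto_ennrealI)
  moreover have "1 / p x < top" for x
    using p[of x] by (auto simp: less_top[symmetric] ennreal_divide_eq_top_iff)
  ultimately show ?thesis by simp
qed

text \<open>Passes from \<open>ennreal\<close> to real numbers. The constant q of the decay
  condition equals 1/P by uniqueness of limits, and P, being also the essential supremum, bounds p
  from above.\<close>

lemma exponent_bounds:
  fixes p :: "'a::euclidean_space \<Rightarrow> ennreal"
  assumes p: "p \<in> log_exponents" "2 \<le> exp_minus p" "exp_minus p \<le> exp_plus p"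
    "exp_plus p < \<infinity>" "exp_plus p = exp_infty p"
  defines "a \<equiv> enn2real (exp_minus p)" and "P \<equiv> enn2real (exp_infty p)"
  obtains c where "2 \<le> a" "a \<le> P" "0 < c"
    "AE x in lebesgue. p x < \<infinity> \<and> a \<le> enn2real (p x) \<and> enn2real (p x) \<le> P \<and>
       1 / enn2real (p x) - 1 / P \<le> c / ln (exp 1 + norm x)"
proof -
  from p(1) obtain c q where c: "0 < c"
    and decay: "\<And>x. \<bar>enn2real (1 / p x) - q\<bar> \<le> c / ln (exp 1 + norm x)"
    and p1: "\<And>x. 1 \<le> p x"
    unfolding log_exponents_def log_Hoelder_def var_exponents_def by blast
  have "((\<lambda>x. 1 / p x) \<longlongrightarrow> ennreal q) at_infinity"
    by (rule inverse_exponent_tendsto[OF p1 decay])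
  then have "exp_infty p = 1 / ennreal q"
    unfolding exp_infty_def by (subst tendsto_Lim[OF trivial_limit_at_infinity]) auto
  \<comment> \<open>For q <= 0 the value \<open>1 / ennreal q\<close> would be infinite, against the
    finiteness of \<open>exp_plus p\<close>.\<close>
  moreover from this have q: "0 < q"
    using p by (cases "0 < q") (auto simp: ennreal_neg)
  ultimately have "exp_infty p = ennreal (1 / q)"
    by (simp add: divide_ennreal ennreal_1[symmetric] del: ennreal_1)
  then have qP: "exp_infty p = ennreal P" "q = 1 / P"
    using q by (simp_all add: P_def)
  have a: "exp_minus p = ennreal a"
    using order.strict_trans1[OF p(3,4)] by (simp add: a_def)
  have "ennreal 2 \<le> ennreal a" using p(2) a by (simp add: ennreal_numeral[symmetric] del: ennreal_numeral)
  then have a2: "2 \<le> a" by (simp add: ennreal_le_iff2)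
  have aP: "a \<le> P" using p(3,5) a qP a2 by (simp add: ennreal_le_iff2)
  have "AE x in lebesgue. p x < \<infinity> \<and> a \<le> enn2real (p x) \<and> enn2real (p x) \<le> P \<and>
       1 / enn2real (p x) - 1 / P \<le> c / ln (exp 1 + norm x)"
    using exp_minus_le_AE[of p] esssup_AE[of p lebesgue]
  proof eventually_elim
    case (elim x)
    then have le: "ennreal a \<le> p x" "p x \<le> ennreal P"
      using p(5) a qP by (simp_all add: exp_plus_def)
    then have fin: "p x < \<infinity>" by (simp add: order.strict_trans1)
    then obtain r where r: "p x = ennreal r" "0 \<le> r" by (cases "p x") auto
    then have ar: "a \<le> r" "r \<le> P" using le a2 aP by (auto simp: ennreal_le_iff2)
    have "1 / p x = ennreal (1 / r)"
      using r ar a2 by (simp add: divide_ennreal ennreal_1[symmetric] del: ennreal_1)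
    then have "1 / r - 1 / P \<le> c / ln (exp 1 + norm x)"
      using decay[of x] r qP by simp
    then show ?case using fin r ar by simp
  qed
  then show ?thesis using that a2 aP c by blast
qed

section \<open>The modular under scaling\<close>

lemma omega_measurable:
  assumes [measurable]: "p \<in> borel_measurable M" "f \<in> borel_measurable M"
  shows "(\<lambda>x. omega (p x) (norm (f x))) \<in> borel_measurable M"
  unfolding omega_def by measurable

text \<open>For exponents at least 1 one has (1/D)^p <= 1/D. This turns a finite bound on the
  modular into the bound 1 by a scaling that does not involve p.\<close>

lemma modular_scaleR_le:
  assumes [measurable]: "p \<in> borel_measurable lebesgue" "f \<in> borel_measurable lebesgue"
    and p: "AE x in lebesgue. 1 \<le> enn2real (p x) \<and> p x < \<infinity>" and D: "1 \<le> D"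
  shows "modular p (\<lambda>x. f x /\<^sub>R D) \<le> ennreal (1 / D) * modular p f"
proof -
  have [measurable]: "(\<lambda>x. omega (p x) (norm (f x))) \<in> borel_measurable lebesgue"
    by (rule omega_measurable) measurable
  have "modular p (\<lambda>x. f x /\<^sub>R D) \<le> (\<integral>\<^sup>+x. ennreal (1 / D) * omega (p x) (norm (f x)) \<partial>lebesgue)"
    unfolding modular_def
  proof (rule nn_integral_mono_AE, use p in eventually_elim)
    case (elim x)
    have "(1 / D) powr enn2real (p x) \<le> (1 / D) powr 1"
      using elim D by (intro powr_mono') auto
    then have "(1 / D * norm (f x)) powr enn2real (p x) \<le> 1 / D * norm (f x) powr enn2real (p x)"
      using D mult_right_mono[of "(1 / D) powr enn2real (p x)" "1 / D" "norm (f x) powr enn2real (p x)"]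
      by (simp add: powr_divide)
    then show ?case
      using elim D by (auto simp: omega_def ennreal_mult'[symmetric] inverse_eq_divide intro!: ennreal_leI)
  qed
  then show ?thesis by (simp add: modular_def nn_integral_cmult)
qed

section \<open>Convolution with \<open>eta\<close>\<close>

text \<open>Joint measurability for Fubini: both coordinates are measurable from the product of
  Lebesgue sigma-algebras into \<open>borel\<close>, and the kernel is Borel.\<close>

lemma eta_diff_measurable [measurable]:
  "(\<lambda>z. eta t m (fst z - snd z)) \<in> borel_measurable (lebesgue \<Otimes>\<^sub>M (lebesgue :: 'a::euclidean_space measure))"
proof -
  have [measurable]: "(\<lambda>x::'a. x) \<in> lebesgue \<rightarrow>\<^sub>M borel"
    by (rule measurable_completion) simp
  have [measurable]: "fst \<in> (lebesgue :: 'a measure) \<Otimes>\<^sub>M (lebesgue :: 'a measure) \<rightarrow>\<^sub>M borel"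
      "snd \<in> (lebesgue :: 'a measure) \<Otimes>\<^sub>M (lebesgue :: 'a measure) \<rightarrow>\<^sub>M borel"
    using measurable_compose[OF measurable_fst, of "\<lambda>x::'a. x" lebesgue borel]
      measurable_compose[OF measurable_snd, of "\<lambda>x::'a. x" lebesgue borel] by simp_all
  show ?thesis by measurable
qed

text \<open>\<open>A\<close> is the convolution of \<open>eta t m\<close> with F, of mass at most K
  by Fubini. The powers A^(2/a) and A^(2/P) are both reduced to A^(1/P), because the P-th power of
  the latter is integrable.\<close>

lemma eta_conv_bound:
  fixes F g :: "'a::euclidean_space \<Rightarrow> real" and t m K a P :: real
  defines "T \<equiv> t powr (- real DIM('a) * theta a P t)"
  assumes t: "0 < t" and m: "0 \<le> m" and K: "0 < K" "(\<integral>\<^sup>+x. ennreal (eta t m (x::'a)) \<partial>lebesgue) \<le> ennreal K"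
    and aP: "2 \<le> a" "a \<le> P"
    and [measurable]: "F \<in> borel_measurable lebesgue" "g \<in> borel_measurable lebesgue"
    and F: "\<And>y. 0 \<le> F y" "(\<integral>\<^sup>+y. ennreal (F y) \<partial>lebesgue) \<le> 1"
    and g: "AE y in lebesgue. g y \<le> F y powr (2 / a) + F y powr (2 / P)"
  obtains A where "A \<in> borel_measurable lebesgue" "\<And>x. 0 \<le> A x"
    "(\<integral>\<^sup>+x. ennreal (A x) \<partial>lebesgue) \<le> ennreal K"
    "\<And>x. (\<integral>\<^sup>+y. ennreal (eta t m (x - y) * g y) \<partial>lebesgue) \<le> ennreal (2 * (K + 1) * T * A x powr (1 / P))"
proof -
  define n where "n = real DIM('a)"
  define G where "G = (\<lambda>x. \<integral>\<^sup>+y. ennreal (eta t m (x - y) * F y) \<partial>lebesgue)"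
  \<comment> \<open>Fubini is applied to the \<open>ennreal\<close>-valued \<open>G\<close>; the
    bound t^(-n) shows that \<open>G\<close> is finite, so that \<open>enn2real\<close> loses
    nothing.\<close>
  define A where "A = (\<lambda>x. enn2real (G x))"
  have eta_meas [measurable]: "(\<lambda>y. eta t m (x - y)) \<in> borel_measurable lebesgue" for x :: 'a
    by (intro measurable_completion) measurable
  have [measurable]: "(\<lambda>z. ennreal (eta t m (fst z - snd z) * F (snd z))) \<in> borel_measurable (lebesgue \<Otimes>\<^sub>M lebesgue)"
    by measurable
  have [measurable]: "G \<in> borel_measurable lebesgue"
    unfolding G_def by (rule lebesgue.borel_measurable_nn_integral) (simp add: case_prod_beta)
  have G_le: "G x \<le> ennreal (t powr (- n))" for x
  proof -
    have "G x \<le> (\<integral>\<^sup>+y. ennreal (t powr (- n)) * ennreal (F y) \<partial>lebesgue)"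
      unfolding G_def n_def
      by (intro nn_integral_mono)
        (simp add: ennreal_mult'[symmetric] ennreal_leI mult_right_mono eta_le[OF t m] F(1))
    also have "\<dots> \<le> ennreal (t powr (- n)) * 1"
      by (subst nn_integral_cmult) (measurable, intro mult_left_mono F(2), simp)
    finally show ?thesis by simp
  qed
  have GA: "G x = ennreal (A x)" for x
    using G_le[of x] by (simp add: A_def order.strict_trans1)
  have A: "0 \<le> A x" "A x \<le> t powr (- n)" for x
    using G_le[of x] by (auto simp: A_def enn2real_leI)
  have "(\<integral>\<^sup>+x. G x \<partial>lebesgue)
      = (\<integral>\<^sup>+y. (\<integral>\<^sup>+x. ennreal (eta t m (x - y) * F y) \<partial>lebesgue) \<partial>lebesgue)"
    unfolding G_def by (rule lebesgue_pair.Fubini'[symmetric]) (simp add: case_prod_beta)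
  also have "\<dots> = (\<integral>\<^sup>+y. (\<integral>\<^sup>+x. ennreal (eta t m (x::'a)) \<partial>lebesgue) * ennreal (F y) \<partial>lebesgue)"
  proof (intro nn_integral_cong)
    fix y :: 'a
    have [measurable]: "(\<lambda>x. eta t m (x - y)) \<in> borel_measurable lebesgue"
      by (intro measurable_completion) measurable
    have "(\<integral>\<^sup>+x. ennreal (eta t m (x - y) * F y) \<partial>lebesgue)
        = (\<integral>\<^sup>+x. ennreal (eta t m (x - y)) \<partial>lebesgue) * ennreal (F y)"
      using F(1) by (subst nn_integral_multc[symmetric]) (auto simp: ennreal_mult')
    also have "(\<integral>\<^sup>+x. ennreal (eta t m (x - y)) \<partial>lebesgue) = (\<integral>\<^sup>+x. ennreal (eta t m (x::'a)) \<partial>lebesgue)"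
      by (rule nn_integral_lebesgue_translate) measurable
    finally show "(\<integral>\<^sup>+x. ennreal (eta t m (x - y) * F y) \<partial>lebesgue)
        = (\<integral>\<^sup>+x. ennreal (eta t m (x::'a)) \<partial>lebesgue) * ennreal (F y)" .
  qed
  also have "\<dots> = (\<integral>\<^sup>+x. ennreal (eta t m (x::'a)) \<partial>lebesgue) * (\<integral>\<^sup>+y. ennreal (F y) \<partial>lebesgue)"
    by (rule nn_integral_cmult) measurable
  also have "\<dots> \<le> ennreal K * 1"
    by (intro mult_mono K F) auto
  finally have int_A: "(\<integral>\<^sup>+x. ennreal (A x) \<partial>lebesgue) \<le> ennreal K" by (simp add: GA)
  \<comment> \<open>The surplus power 1/s - 1/P of A is estimated by A <= t^(-n). It lies between
    1/P and 2/a - 1/P; the upper end is compared with \<open>theta\<close> for t <= 1 and the lower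
    end for t > 1, since powers of t change monotonicity at 1.\<close>
  have A_powr: "A x powr (1 / s) \<le> T * A x powr (1 / P)" if s: "s = a / 2 \<or> s = P / 2" for s x
  proof -
    have d: "1 / P \<le> 1 / s - 1 / P" "1 / s - 1 / P \<le> 2 / a - 1 / P"
      using s aP by (auto simp: field_simps)
    then have e0: "0 \<le> 1 / s - 1 / P" using aP by (smt (verit) zero_le_divide_1_iff)
    have "t powr (- n * (1 / s - 1 / P)) \<le> T"
    proof (cases "t \<le> 1")
      case True
      then have "n * (1 / s - 1 / P) \<le> n * theta a P t"
        using theta_ge[OF aP True] d by (intro mult_left_mono) (auto simp: n_def)
      then show ?thesis using True t by (auto simp: T_def n_def intro!: powr_mono')
    next
      case False
      then have "n * theta a P t \<le> n * (1 / s - 1 / P)"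
        using theta_le[OF aP, of t] d by (intro mult_left_mono) (auto simp: n_def)
      then show ?thesis using False t by (auto simp: T_def n_def intro!: powr_mono)
    qed
    moreover have "A x powr (1 / s - 1 / P) \<le> (t powr (- n)) powr (1 / s - 1 / P)"
      using A e0 by (intro powr_mono2)
    ultimately have "A x powr (1 / s - 1 / P) \<le> T" by (simp add: powr_powr)
    then have "A x powr (1 / s - 1 / P) * A x powr (1 / P) \<le> T * A x powr (1 / P)"
      by (intro mult_right_mono) auto
    then show ?thesis by (simp add: powr_add[symmetric])
  qed
  \<comment> \<open>The Jensen-type bound requires s >= 1, which follows from 2 <= a <= P; by
    reflection the kernel centred at x has the mass of \<open>eta t m\<close>.\<close>
  have part: "(\<integral>\<^sup>+y. ennreal (eta t m (x - y) * F y powr (1 / s)) \<partial>lebesgue)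
      \<le> ennreal ((K + 1) * (T * A x powr (1 / P)))" if s: "s = a / 2 \<or> s = P / 2" for s x
  proof -
    have "(\<integral>\<^sup>+y. ennreal (eta t m (x - y)) \<partial>lebesgue) \<le> ennreal K"
      using K nn_integral_lebesgue_reflect[of "\<lambda>y. ennreal (eta t m y)" x] by simp
    moreover have "(\<integral>\<^sup>+y. ennreal (eta t m (x - y) * F y) \<partial>lebesgue) \<le> ennreal (A x)"
      using GA by (simp add: G_def)
    ultimately have "(\<integral>\<^sup>+y. ennreal (eta t m (x - y) * F y powr (1 / s)) \<partial>lebesgue)
      \<le> ennreal ((K + 1) * A x powr (1 / s))"
      using K A F(1) s aP by (intro nn_integral_powr_inverse_le) auto
    also have "\<dots> \<le> ennreal ((K + 1) * (T * A x powr (1 / P)))"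
      using A_powr[OF s] K by (intro ennreal_leI mult_left_mono) auto
    finally show ?thesis .
  qed
  have "(\<integral>\<^sup>+y. ennreal (eta t m (x - y) * g y) \<partial>lebesgue)
      \<le> ennreal (2 * (K + 1) * T * A x powr (1 / P))" for x
  proof -
    have "(\<integral>\<^sup>+y. ennreal (eta t m (x - y) * g y) \<partial>lebesgue) \<le>
      (\<integral>\<^sup>+y. ennreal (eta t m (x - y) * F y powr (1 / (a / 2)))
         + ennreal (eta t m (x - y) * F y powr (1 / (P / 2))) \<partial>lebesgue)"
    proof (rule nn_integral_mono_AE, use g in eventually_elim)
      case (elim y)
      have "eta t m (x - y) * g y \<le> eta t m (x - y) * (F y powr (2 / a) + F y powr (2 / P))"
        using elim by (intro mult_left_mono) auto
      then show ?case
        by (simp add: ennreal_plus[symmetric] ring_distribs ennreal_leI del: ennreal_plus)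
    qed
    also have "\<dots> = (\<integral>\<^sup>+y. ennreal (eta t m (x - y) * F y powr (1 / (a / 2))) \<partial>lebesgue)
         + (\<integral>\<^sup>+y. ennreal (eta t m (x - y) * F y powr (1 / (P / 2))) \<partial>lebesgue)"
      by (rule nn_integral_add) measurable
    also have "\<dots> \<le> ennreal ((K + 1) * (T * A x powr (1 / P))) + ennreal ((K + 1) * (T * A x powr (1 / P)))"
      by (intro add_mono part) auto
    also have "\<dots> = ennreal (2 * (K + 1) * T * A x powr (1 / P))"
      using K by (simp add: ennreal_plus[symmetric] T_def algebra_simps del: ennreal_plus)
    finally show ?thesis .
  qed
  then show ?thesis
    using int_A A(1) by (intro that[of A]) (auto simp: A_def)
qed

lemma half_exponent:
  assumes "q < (\<infinity> :: ennreal)"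
  shows "q / 2 < \<infinity>" "enn2real (q / 2) = enn2real q / 2"
proof -
  obtain r where r: "q = ennreal r" "0 \<le> r" using assms by (cases q) auto
  then have "q / 2 = ennreal (r / 2)"
    by (simp add: divide_ennreal ennreal_numeral[symmetric] del: ennreal_numeral)
  then show "q / 2 < \<infinity>" "enn2real (q / 2) = enn2real q / 2" using r by simp_all
qed

lemma conv_measurable:
  fixes f :: "'a::euclidean_space \<Rightarrow> 'b::{banach, second_countable_topology}"
  assumes [measurable]: "f \<in> borel_measurable lebesgue"
  shows "conv (eta t m) f \<in> borel_measurable lebesgue"
  unfolding conv_def[abs_def]
  by (rule lebesgue.borel_measurable_lebesgue_integral) (simp add: case_prod_beta)

text \<open>The normalised case, from which homogeneity gives the theorem. In the constant, 2 * (K +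
  1) * T comes from \<open>eta_conv_bound\<close>, exp (c * m) from the passage from constant
  exponent P to p(x), and 2 * K + 1 brings the modular bound 2 * K below 1.\<close>

lemma modular_conv_eta_le:
  fixes p :: "'a::euclidean_space \<Rightarrow> ennreal" and f :: "'a \<Rightarrow> 'b::{banach, second_countable_topology}"
    and t m K a P c :: real
  defines "T \<equiv> t powr (- real DIM('a) * theta a P t)"
  assumes t: "0 < t" and m: "real DIM('a) < m" and c: "0 < c"
    and K: "0 < K" "\<forall>t>0. (\<integral>\<^sup>+x. ennreal (eta t m (x::'a)) \<partial>lebesgue) \<le> ennreal K"
    and aP: "2 \<le> a" "a \<le> P"
    and [measurable]: "p \<in> borel_measurable lebesgue" "f \<in> borel_measurable lebesgue"
    and p: "AE x in lebesgue. p x < \<infinity> \<and> a \<le> enn2real (p x) \<and> enn2real (p x) \<le> P \<and>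
       1 / enn2real (p x) - 1 / P \<le> c / ln (exp 1 + norm x)"
    and f: "modular (\<lambda>x. p x / 2) f \<le> 1"
  shows "integrable lebesgue (\<lambda>y. eta t m (x - y) *\<^sub>R f y)"
    and "modular p (\<lambda>x. conv (eta t m) f x /\<^sub>R (2 * (K + 1) * (2 * K + 1) * exp (c * m) * T)) \<le> 1"
proof -
  have T: "0 < T" using t by (simp add: T_def)
  have m0: "0 < m" using m by (smt (verit) of_nat_0_le_iff)
  define F where "F = (\<lambda>y. norm (f y) powr (enn2real (p y) / 2))"
  have [measurable]: "F \<in> borel_measurable lebesgue" unfolding F_def by measurable
  have "(\<integral>\<^sup>+y. ennreal (F y) \<partial>lebesgue) = modular (\<lambda>x. p x / 2) f"
    unfolding modular_def
  proof (rule nn_integral_cong_AE, use p in eventually_elim)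
    case (elim y)
    then have fin: "p y < \<infinity>" by simp
    then show ?case
      using half_exponent(1)[OF fin] by (simp add: omega_def F_def half_exponent(2)[OF fin])
  qed
  then have F: "(\<integral>\<^sup>+y. ennreal (F y) \<partial>lebesgue) \<le> 1" using f by simp
  \<comment> \<open>Where |f| <= 1 the term F^(2/P) dominates, as p(y) <= P; elsewhere F^(2/a) does,
    as a <= p(y).\<close>
  have f_le: "AE y in lebesgue. norm (f y) \<le> F y powr (2 / a) + F y powr (2 / P)"
    using p
  proof eventually_elim
    case (elim y)
    define r where "r = enn2real (p y)"
    have r: "a \<le> r" "r \<le> P" using elim by (auto simp: r_def)
    have F_powr: "F y powr (2 / s) = norm (f y) powr (r / s)" for s
      by (simp add: F_def r_def powr_powr)
    show ?case
    proof (cases "norm (f y) \<le> 1")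
      case True
      then have "norm (f y) powr 1 \<le> norm (f y) powr (r / P)"
        using r aP by (intro powr_mono') auto
      then show ?thesis by (simp add: F_powr add_increasing)
    next
      case False
      then have "norm (f y) powr 1 \<le> norm (f y) powr (r / a)"
        using r aP by (intro powr_mono) auto
      then show ?thesis by (simp add: F_powr add_increasing2)
    qed
  qed
  obtain A where [measurable]: "A \<in> borel_measurable lebesgue" and A: "\<And>x. 0 \<le> A x"
    "(\<integral>\<^sup>+x. ennreal (A x) \<partial>lebesgue) \<le> ennreal K"
    "\<And>x. (\<integral>\<^sup>+y. ennreal (eta t m (x - y) * norm (f y)) \<partial>lebesgue)
       \<le> ennreal (2 * (K + 1) * T * A x powr (1 / P))"
    using eta_conv_bound[OF t less_imp_le[OF m0] K(1) K(2)[rule_format, OF t] aP, of F "\<lambda>y. norm (f y)"] F f_le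
    by (auto simp: F_def T_def)
  \<comment> \<open>The bound through \<open>A\<close> is finite at each x, so integrability holds
    everywhere and not only almost everywhere.\<close>
  have int: "integrable lebesgue (\<lambda>y. eta t m (x - y) *\<^sub>R f y)" for x
  proof (rule integrableI_bounded)
    have [measurable]: "(\<lambda>y. eta t m (x - y)) \<in> borel_measurable lebesgue"
      by (intro measurable_completion) measurable
    show "(\<lambda>y. eta t m (x - y) *\<^sub>R f y) \<in> borel_measurable lebesgue" by measurable
    show "(\<integral>\<^sup>+y. ennreal (norm (eta t m (x - y) *\<^sub>R f y)) \<partial>lebesgue) < \<infinity>"
      using A(3)[of x] by (simp add: order.strict_trans1)
  qed
  then show "integrable lebesgue (\<lambda>y. eta t m (x - y) *\<^sub>R f y)" .
  have conv_le: "norm (conv (eta t m) f x) \<le> 2 * (K + 1) * T * A x powr (1 / P)" for x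
  proof -
    have "ennreal (norm (conv (eta t m) f x)) \<le> (\<integral>\<^sup>+y. ennreal (eta t m (x - y) * norm (f y)) \<partial>lebesgue)"
      using integral_norm_bound_ennreal[OF int[of x]] by (simp add: conv_def)
    also note A(3)
    finally show ?thesis using K T A(1) by (simp add: ennreal_le_iff)
  qed
  define B where "B = 2 * (K + 1) * T * exp (c * m)"
  define h where "h = (\<lambda>x. conv (eta t m) f x /\<^sub>R B)"
  have B: "0 < B" using K T by (simp add: B_def)
  have h_meas [measurable]: "h \<in> borel_measurable lebesgue"
    unfolding h_def using conv_measurable[of f t m] by measurable
  have eta_meas [measurable]: "(eta 1 m :: 'a \<Rightarrow> real) \<in> borel_measurable lebesgue"
    by (intro measurable_completion) measurable
  \<comment> \<open>Here exponent P is traded for p(x). The error exp (- m * L) = (e + |x|)^(-m) is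
    at most (1 + |x|)^(-m), the kernel at scale 1, whose mass is again at most K.\<close>
  have "modular p h \<le> (\<integral>\<^sup>+x. ennreal (A x) + ennreal (eta 1 m x) \<partial>lebesgue)"
    unfolding modular_def
  proof (rule nn_integral_mono_AE, use p in eventually_elim)
    case (elim x)
    define L where "L = ln (exp 1 + norm x)"
    have "1 \<le> L"
      unfolding L_def using ln_mono[of "exp 1" "exp 1 + norm x"] by simp
    have "norm (h x) = norm (conv (eta t m) f x) / B"
      using B by (simp add: h_def divide_inverse mult.commute)
    also have "\<dots> \<le> 2 * (K + 1) * T * A x powr (1 / P) / B"
      using conv_le[of x] B by (intro divide_right_mono) auto
    also have "\<dots> = exp (- c * m) * A x powr (1 / P)"
      using K(1) T nonzero_mult_divide_mult_cancel_left[of "2 * (K + 1) * T" "A x powr (1 / P)" "exp (c * m)"]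
      unfolding B_def by (simp add: exp_minus divide_inverse mult.commute)
    finally have "norm (h x) \<le> exp (- c * m) * A x powr (1 / P)" .
    then have "norm (h x) powr enn2real (p x) \<le> (exp (- c * m) * A x powr (1 / P)) powr enn2real (p x)"
      using elim aP by (intro powr_mono2) auto
    also have "\<dots> \<le> (A x powr (1 / P)) powr P + exp (- m * L)"
      using elim aP c m0 \<open>1 \<le> L\<close> by (intro powr_le_powr_plus_decay) (auto simp: L_def)
    also have "(A x powr (1 / P)) powr P = A x" using A(1)[of x] aP by (simp add: powr_powr)
    also have "exp (- m * L) = (exp 1 + norm x) powr (- m)"
      by (simp add: powr_def L_def add_pos_nonneg[THEN less_imp_neq, symmetric])
    also have "\<dots> \<le> eta 1 m x"
      unfolding eta_def using m0 by (auto intro!: powr_mono2' add_pos_nonneg)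
    finally show ?case
      using elim A(1)[of x] by (auto simp: omega_def ennreal_plus[symmetric] simp del: ennreal_plus intro!: ennreal_leI)
  qed
  also have "\<dots> = (\<integral>\<^sup>+x. ennreal (A x) \<partial>lebesgue) + (\<integral>\<^sup>+x. ennreal (eta 1 m (x::'a)) \<partial>lebesgue)"
    by (rule nn_integral_add) measurable
  also have "\<dots> \<le> ennreal K + ennreal K"
    by (intro add_mono A K(2)[rule_format]) simp
  also have "\<dots> = ennreal (2 * K)" using K(1) by (simp add: ennreal_plus[symmetric] del: ennreal_plus)
  finally have h_le: "modular p h \<le> ennreal (2 * K)" .
  have "AE x in lebesgue. 1 \<le> enn2real (p x) \<and> p x < \<infinity>"
    using p by eventually_elim (use aP in auto)
  then have "modular p (\<lambda>x. h x /\<^sub>R (2 * K + 1)) \<le> ennreal (1 / (2 * K + 1)) * modular p h"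
    using K(1) by (intro modular_scaleR_le) auto
  also have "\<dots> \<le> ennreal (1 / (2 * K + 1)) * ennreal (2 * K)"
    by (intro mult_left_mono h_le) simp
  also have "\<dots> \<le> 1"
    using K(1) by (simp add: ennreal_mult'[symmetric])
  finally show "modular p (\<lambda>x. conv (eta t m) f x /\<^sub>R (2 * (K + 1) * (2 * K + 1) * exp (c * m) * T)) \<le> 1"
    by (simp add: h_def B_def mult_ac)
qed

section \<open>From the modular to the Luxemburg norm\<close>

text \<open>If k * f has finite modular M, a further division by M + 1 brings it to at most M / (M +
  1); hence l = (M + 1) / k.\<close>

lemma Lp_var_modular_le_1:
  assumes [measurable]: "p \<in> borel_measurable lebesgue" and f: "f \<in> Lp_var p"
    and p: "AE x in lebesgue. 1 \<le> enn2real (p x) \<and> p x < \<infinity>"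
  obtains l where "0 < l" "modular p (\<lambda>x. f x /\<^sub>R l) \<le> 1"
proof -
  from f obtain k where [measurable]: "f \<in> borel_measurable lebesgue"
    and k: "0 < k" "modular p (\<lambda>x. k *\<^sub>R f x) < \<infinity>"
    by (auto simp: Lp_var_def)
  define M where "M = enn2real (modular p (\<lambda>x. k *\<^sub>R f x))"
  have M: "0 \<le> M" "modular p (\<lambda>x. k *\<^sub>R f x) = ennreal M"
    using k by (simp_all add: M_def)
  have "modular p (\<lambda>x. (k *\<^sub>R f x) /\<^sub>R (M + 1)) \<le> ennreal (1 / (M + 1)) * modular p (\<lambda>x. k *\<^sub>R f x)"
    using M(1) p by (intro modular_scaleR_le) auto
  also have "\<dots> \<le> 1" using M by (simp add: ennreal_mult'[symmetric])
  finally have "modular p (\<lambda>x. f x /\<^sub>R ((M + 1) / k)) \<le> 1"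
    by (simp add: field_simps)
  then show ?thesis using k M by (intro that[of "(M + 1) / k"]) auto
qed

text \<open>If l is admissible for f, then B * l is admissible for h, so the infima compare.
  Division by B comes first so that the bound can be tested against each l.\<close>

lemma Lp_var_norm_le_mult:
  assumes B: "0 < B"
    and h: "\<And>l. 0 < l \<Longrightarrow> modular q (\<lambda>x. f x /\<^sub>R l) \<le> 1 \<Longrightarrow> modular p (\<lambda>x. h x /\<^sub>R (B * l)) \<le> 1"
  shows "Lp_var_norm p h \<le> ennreal B * Lp_var_norm q f"
proof -
  have "Lp_var_norm p h / ennreal B \<le> Lp_var_norm q f"
    unfolding Lp_var_norm_def[of q]
  proof (rule INF_greatest)
    fix l assume "l \<in> {l. 0 < l \<and> modular q (\<lambda>x. f x /\<^sub>R l) \<le> 1}"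
    then have "Lp_var_norm p h \<le> ennreal (B * l)"
      unfolding Lp_var_norm_def using B h by (intro INF_lower) auto
    then show "Lp_var_norm p h / ennreal B \<le> ennreal l"
      using B by (intro divide_le_posI_ennreal) (auto simp: ennreal_mult')
  qed
  then have "ennreal B * (Lp_var_norm p h / ennreal B) \<le> ennreal B * Lp_var_norm q f"
    by (rule mult_left_mono) simp
  then show ?thesis
    using B by (simp add: ennreal_times_divide mult_divide_eq_ennreal mult.commute[of "ennreal B"])
qed

theorem lemma3p2:
  fixes p :: "real ^ 'n \<Rightarrow> ennreal" and m :: real
  assumes "p \<in> log_exponents"
    and "m > real CARD('n)"
    and "2 \<le> exp_minus p" and "exp_minus p \<le> exp_plus p" and "exp_plus p < \<infinity>"
    and "exp_plus p = exp_infty p"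
  shows "\<exists>C::real. C > 0 \<and>
    (\<forall>t::real. \<forall>f :: real ^ 'n \<Rightarrow> complex.
       t > 0 \<longrightarrow> f \<in> Lp_var (\<lambda>x. p x / 2) \<longrightarrow>
         conv_exists (eta t m) f \<and> conv (eta t m) f \<in> Lp_var p \<and>
         Lp_var_norm p (conv (eta t m) f)
           \<le> ennreal (C * t powr (- real CARD('n) *
                 theta (enn2real (exp_minus p)) (enn2real (exp_infty p)) t))
             * Lp_var_norm (\<lambda>x. p x / 2) f)"
proof -
  define a where "a = enn2real (exp_minus p)"
  define P where "P = enn2real (exp_infty p)"
  have [measurable]: "p \<in> borel_measurable lebesgue"
    using assms(1) by (simp add: log_exponents_def var_exponents_def)
  obtain c where aP: "2 \<le> a" "a \<le> P" and c: "0 < c"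
    and p: "AE x in lebesgue. p x < \<infinity> \<and> a \<le> enn2real (p x) \<and> enn2real (p x) \<le> P \<and>
       1 / enn2real (p x) - 1 / P \<le> c / ln (exp 1 + norm x)"
    using exponent_bounds[OF assms(1,3-6)] unfolding a_def P_def by blast
  have dim: "DIM(real ^ 'n) = CARD('n)" by simp
  obtain K where K: "0 < K"
    "\<forall>t>0. (\<integral>\<^sup>+x. ennreal (eta t m (x :: real ^ 'n)) \<partial>lebesgue) \<le> ennreal K"
    using nn_integral_eta_bounded[where 'a = "real ^ 'n", of m] assms(2) unfolding dim by blast
  \<comment> \<open>Fixed before t and f: \<open>K\<close> is obtained from n and m, and
    \<open>c\<close> from p.\<close>
  define C where "C = 2 * (K + 1) * (2 * K + 1) * exp (c * m)"
  have C: "0 < C" using K by (simp add: C_def)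
  have half: "AE x in lebesgue. 1 \<le> enn2real (p x / 2) \<and> p x / 2 < \<infinity>"
    using p
  proof eventually_elim
    case (elim x)
    then have fin: "p x < \<infinity>" and "2 \<le> enn2real (p x)" using aP by auto
    then show ?case
      using half_exponent(1)[OF fin] by (simp add: half_exponent(2)[OF fin])
  qed
  show ?thesis
    unfolding a_def[symmetric] P_def[symmetric]
  proof (intro exI[of _ C] conjI C allI impI)
    fix t :: real and f :: "real ^ 'n \<Rightarrow> complex"
    assume t: "0 < t" and f: "f \<in> Lp_var (\<lambda>x. p x / 2)"
    define B where "B = C * t powr (- real CARD('n) * theta a P t)"
    have B: "0 < B" using C t by (simp add: B_def)
    have [measurable]: "f \<in> borel_measurable lebesgue" using f by (simp add: Lp_var_def)
    note bound = modular_conv_eta_le[where p = p and t = t and m = m and K = K and a = a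
        and P = P and c = c and 'a = "real ^ 'n", unfolded dim, OF t assms(2) c K aP _ _ p]
    obtain l where l: "0 < l" "modular (\<lambda>x. p x / 2) (\<lambda>x. f x /\<^sub>R l) \<le> 1"
      using Lp_var_modular_le_1[OF _ f half] by auto
    \<comment> \<open>The normalised case covers f / l; multiplication by l returns integrability
      for f.\<close>
    have "integrable lebesgue (\<lambda>y. eta t m (x - y) *\<^sub>R f y)" for x
      using integrable_scaleR_right[OF bound(1)[OF _ _ l(2), of x], of l] l(1)
      by (simp add: mult.left_commute[of l])
    then show "conv_exists (eta t m) f" by (simp add: conv_exists_def)
    have conv_bound: "modular p (\<lambda>x. conv (eta t m) f x /\<^sub>R (B * l)) \<le> 1"
      if l: "0 < l" "modular (\<lambda>x. p x / 2) (\<lambda>x. f x /\<^sub>R l) \<le> 1" for l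
    proof -
      have "conv (eta t m) (\<lambda>x. f x /\<^sub>R l) x = conv (eta t m) f x /\<^sub>R l" for x
        unfolding conv_def by (subst integral_scaleR_right[symmetric]) (simp add: mult.commute)
      then show ?thesis
        using bound(2)[OF _ _ l(2)] by (simp add: B_def C_def mult_ac)
    qed
    show "Lp_var_norm p (conv (eta t m) f) \<le>
        ennreal (C * t powr (- real CARD('n) * theta a P t)) * Lp_var_norm (\<lambda>x. p x / 2) f"
      unfolding B_def[symmetric] by (rule Lp_var_norm_le_mult[OF B conv_bound])
    \<comment> \<open>The witness is the inverse of B * l, at which the modular is at most
      1.\<close>
    show "conv (eta t m) f \<in> Lp_var p"
      unfolding Lp_var_def
      using conv_measurable[of f t m] conv_bound[OF l] l(1) B
      by (auto intro!: exI[of _ "inverse (B * l)"] intro: order.strict_trans1)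
  qed
qed

end
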